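(* Let $\mathbb{E}$ be a (finite-dimensional) Euclidean space and $f\in\Gamma_0(\mathbb{E})$. Define $P_f:\mathbb{E}\times\mathbb{R}\rightrightarrows\mathbb{E}$ by $P_f(x,\lambda)=P_\lambda f(x)$ if $\lambda>0$, $P_f(x,0)=P_{\mathrm{cl}(\mathrm{dom} f)}(x)$, and $P_f(x,\lambda)=\emptyset$ if $\lambda<0$. Then $P_f$ is continuous on $\mathrm{dom}\,P_f=\mathbb{E}\times\mathbb{R}_+$ and is locally Lipschitz on $\mathrm{int}(\mathrm{dom}\,P_f)$. If $\bar x\in\mathrm{dom}\,\partial f$, then $P_f$ is upper Lipschitz (calm) at $(\bar x,0)$ and the map $\mathbb{R}_+\ni\mu\mapsto P_f(\bar x,\mu)$ is locally Lipschitz at $0$; i.e., there exist positive scalars $\kappa$ and $\varepsilon$ such that $$\|P_f(\bar x,0)-P_f(x,\lambda)\|\le\kappa\|(\bar x-x,\lambda)\|\qquad\forall(x,\lambda)\in B_\varepsilon(\bar x,0)\cap\mathrm{dom}\,P_f,$$ $$\|P_f(\bar x,\lambda)-P_f(\bar x,\mu)\|\le\kappa|\mu-\lambda|\qquad\forall\lambda,\mu\in[0,\varepsilon].$$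
   Context: $\Gamma_0(\mathbb{E})$ denotes the closed proper convex functions $\mathbb{E}\to\mathbb{R}\cup\{+\infty\}$. For $\lambda>0$, $P_\lambda f(x)=\mathrm{argmin}_{u\in\mathbb{E}}\{f(u)+\frac1{2\lambda}\|x-u\|^2\}$. $P_C$ is the Euclidean projection onto a closed convex set $C$. $\mathrm{dom}\,\partial f=\{x\mid\partial f(x)\ne\emptyset\}$, $\mathbb{R}_+=[0,\infty)$, and $B_\varepsilon(\bar x,0)$ is the ball of radius $\varepsilon$ around $(\bar x,0)$ in $\mathbb{E}\times\mathbb{R}$. Singletons are identified with their elements. *)

theory Defs
  imports "HOL-Analysis.Analysis"
begin

definition edom :: "('a \<Rightarrow> ereal) \<Rightarrow> 'a set" where
  "edom f = {x. f x < \<infinity>}"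

definition epi :: "('a \<Rightarrow> ereal) \<Rightarrow> ('a \<times> real) set" where
  "epi f = {(x, r). f x \<le> ereal r}"

definition Gamma0 :: "('a::euclidean_space \<Rightarrow> ereal) set" where
  "Gamma0 = {f. convex (epi f) \<and> closed (epi f) \<and> (\<forall>x. f x \<noteq> - \<infinity>) \<and> edom f \<noteq> {}}"

definition subdifferential :: "('a::euclidean_space \<Rightarrow> ereal) \<Rightarrow> 'a \<Rightarrow> 'a set" where
  "subdifferential f x = {v. \<forall>y. f x + ereal (v \<bullet> (y - x)) \<le> f y}"

definition dom_subdifferential :: "('a::euclidean_space \<Rightarrow> ereal) \<Rightarrow> 'a set" where
  "dom_subdifferential f = {x. subdifferential f x \<noteq> {}}"

definition set_dom :: "('a \<Rightarrow> 'b set) \<Rightarrow> 'a set" where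
  "set_dom F = {x. F x \<noteq> {}}"

definition prox :: "real \<Rightarrow> ('a::euclidean_space \<Rightarrow> ereal) \<Rightarrow> 'a \<Rightarrow> 'a set" where
  "prox l f x = {u. is_arg_min (\<lambda>u. f u + ereal (1 / (2 * l) * (norm (x - u))\<^sup>2)) (\<lambda>_. True) u}"

(* closest_point is meaningful only for a nonempty closed set; closure (edom f) is
   nonempty for every f in Gamma0. *)

definition Pmap :: "('a::euclidean_space \<Rightarrow> ereal) \<Rightarrow> 'a \<times> real \<Rightarrow> 'a set" where
  "Pmap f = (\<lambda>(x, l).
     if l > 0 then prox l f x
     else if l = 0 then {closest_point (closure (edom f)) x}
     else {})"

(* The library's local_lipschitz concerns families of maps indexed by a metric
   parameter space, hence this version for a single map. *)

definition locally_lipschitz_on ::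
    "'a::metric_space set \<Rightarrow> ('a \<Rightarrow> 'b::metric_space) \<Rightarrow> bool" where
  "locally_lipschitz_on S g \<longleftrightarrow> (\<forall>p\<in>S. \<exists>e>0. \<exists>L. L-lipschitz_on (ball p e \<inter> S) g)"

end

theory Submission
  imports Defs
begin

text \<open>
  The proof rests on two facts.  For \<open>\<lambda> > 0\<close> the proximal problem has a minimizer \<open>p\<close>, because
  \<open>f\<close> has an affine minorant and its epigraph is closed, and Fermat's rule gives
  \<open>(x - p) / \<lambda> \<in> \<partial>f(p)\<close>.  Moreover, \<open>\<partial>f\<close> is monotone.  Monotonicity applied to
  \<open>p = P\<^sub>\<lambda>f(x)\<close> and \<open>q = P\<^sub>\<mu>f(y)\<close> yields uniqueness and the estimate
  \<open>\<parallel>p - q\<parallel> \<le> \<parallel>x - y\<parallel> + \<bar>\<lambda> - \<mu>\<bar> \<parallel>y - q\<parallel> / \<mu>\<close> (\<open>prox_point_estimate\<close>), from which the local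
  Lipschitz property on \<open>\<lambda> > 0\<close> is immediate.  If \<open>v \<in> \<partial>f(z)\<close>, monotonicity applied
  to \<open>(p, (x - p) / \<lambda>)\<close> and \<open>(z, v)\<close> yields \<open>\<parallel>p - z\<parallel> \<le> \<parallel>x - z\<parallel> + \<lambda> \<parallel>v\<parallel>\<close>
  (\<open>prox_point_calm\<close>); with \<open>x = z\<close> it bounds the quotient \<open>\<parallel>y - q\<parallel> / \<mu>\<close> in the first estimate by
  \<open>\<parallel>v\<parallel>\<close>, so that both estimates at \<open>(z, 0)\<close> hold with constant \<open>1 + \<parallel>v\<parallel>\<close>.

  Continuity at \<open>(x, 0)\<close> reduces, by nonexpansiveness in \<open>x\<close>, to the convergence of
  \<open>P\<^sub>\<lambda>f(x)\<close> to the projection \<open>c\<close> of \<open>x\<close> onto the closure of the domain as \<open>\<lambda> \<down> 0\<close>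
  (\<open>prox_point_tendsto_projection\<close>).  There the subgradient inequality is tested at a point \<open>u\<close> of
  the domain close to \<open>c\<close>, and \<open>f(P\<^sub>\<lambda>f(x))\<close> is bounded below by the affine minorant.
\<close>

section \<open>Subgradients of closed proper convex functions\<close>

lemma Gamma0_finite:
  assumes "f \<in> Gamma0" "f x < \<infinity>"
  obtains r where "f x = ereal r"
  using assms by (cases "f x") (auto simp: Gamma0_def)

lemma Gamma0_edom_nonempty:
  assumes "f \<in> Gamma0"
  obtains x r where "f x = ereal r"
proof -
  from assms obtain x where "f x < \<infinity>"
    by (auto simp: Gamma0_def edom_def)
  then show thesis
    using Gamma0_finite[OF assms] that by metis
qed

lemma Gamma0_convex_ineq:
  assumes f: "f \<in> Gamma0" and p: "f p = ereal a" and u: "f u = ereal b"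
    and t: "0 \<le> t" "t \<le> 1"
  shows "f (p + t *\<^sub>R (u - p)) \<le> ereal (a + t * (b - a))"
proof -
  have "convex (epi f)" "(p, a) \<in> epi f" "(u, b) \<in> epi f"
    using f p u by (auto simp: Gamma0_def epi_def)
  then have "(1 - t) *\<^sub>R (p, a) + t *\<^sub>R (u, b) \<in> epi f"
    using t by (intro convexD) auto
  then show ?thesis
    by (simp add: epi_def algebra_simps)
qed

lemma convex_edom:
  assumes f: "f \<in> Gamma0"
  shows "convex (edom f)"
  unfolding convex_alt
proof (intro ballI allI impI)
  fix x y and t :: real
  assume x: "x \<in> edom f" and y: "y \<in> edom f" and t: "0 \<le> t \<and> t \<le> 1"
  obtain a where "f x = ereal a" using x Gamma0_finite[OF f] by (auto simp: edom_def)
  moreover obtain b where "f y = ereal b" using y Gamma0_finite[OF f] by (auto simp: edom_def)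
  ultimately have "f (x + t *\<^sub>R (y - x)) \<le> ereal (a + t * (b - a))"
    using Gamma0_convex_ineq[OF f] t by blast
  then have "f (x + t *\<^sub>R (y - x)) < \<infinity>"
    by (rule le_less_trans) simp
  then show "(1 - t) *\<^sub>R x + t *\<^sub>R y \<in> edom f"
    by (simp add: edom_def algebra_simps)
qed

lemma Gamma0_affine_minorant:
  fixes f :: "'a::euclidean_space \<Rightarrow> ereal"
  assumes f: "f \<in> Gamma0"
  obtains v b where "\<And>x r. f x \<le> ereal r \<Longrightarrow> v \<bullet> x + b \<le> r"
proof -
  obtain x0 r0 where x0: "f x0 = ereal r0"
    using Gamma0_edom_nonempty[OF f] .
  \<comment> \<open>A hyperplane that separates a point just below the graph from the epigraph is not vertical.\<close>
  have "(x0, r0 - 1) \<notin> epi f"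
    using x0 by (simp add: epi_def)
  moreover have "convex (epi f)" "closed (epi f)"
    using f by (auto simp: Gamma0_def)
  ultimately obtain w d where wd: "w \<bullet> (x0, r0 - 1) < d" "\<forall>z\<in>epi f. w \<bullet> z > d"
    using separating_hyperplane_closed_point by blast
  obtain a c where w: "w = (a, c)"
    by (cases w)
  have sep: "a \<bullet> x + c * r > d" if "f x \<le> ereal r" for x r
    using wd(2) that unfolding w epi_def by auto
  have "c > 0"
    using sep[of x0 r0] wd(1) x0 unfolding w by (simp add: algebra_simps)
  have "(- a /\<^sub>R c) \<bullet> x + d / c \<le> r" if "f x \<le> ereal r" for x r
    using sep[OF that] \<open>c > 0\<close> by (simp add: field_simps)
  then show thesis
    by (rule that)
qed

lemma subdifferential_finite:
  assumes f: "f \<in> Gamma0" and v: "v \<in> subdifferential f p"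
  obtains a where "f p = ereal a"
proof -
  obtain x r where "f x = ereal r"
    using Gamma0_edom_nonempty[OF f] .
  moreover have "f p + ereal (v \<bullet> (x - p)) \<le> f x"
    using v by (simp add: subdifferential_def)
  ultimately have "f p < \<infinity>"
    by (cases "f p") auto
  then show thesis
    using Gamma0_finite[OF f] that by blast
qed

lemma subdifferential_monotone:
  assumes f: "f \<in> Gamma0" and v: "v \<in> subdifferential f p" and w: "w \<in> subdifferential f q"
  shows "0 \<le> (v - w) \<bullet> (p - q)"
proof -
  obtain a where a: "f p = ereal a" using subdifferential_finite[OF f v] .
  obtain b where b: "f q = ereal b" using subdifferential_finite[OF f w] .
  have "f p + ereal (v \<bullet> (q - p)) \<le> f q" "f q + ereal (w \<bullet> (p - q)) \<le> f p"
    using v w by (auto simp: subdifferential_def)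
  then show ?thesis
    using a b by (simp add: inner_diff_left inner_diff_right)
qed

section \<open>The proximal point\<close>

lemma prox_nonempty:
  fixes f :: "'a::euclidean_space \<Rightarrow> ereal"
  assumes f: "f \<in> Gamma0" and l: "l > 0"
  shows "prox l f x \<noteq> {}"
proof -
  obtain v b where minor: "\<And>x r. f x \<le> ereal r \<Longrightarrow> v \<bullet> x + b \<le> r"
    using Gamma0_affine_minorant[OF f] by blast
  obtain x0 r0 where x0: "f x0 = ereal r0"
    using Gamma0_edom_nonempty[OF f] .
  \<comment> \<open>The objective is minimized over a compact sublevel set inside the epigraph, where it is a
      continuous real-valued function.\<close>
  define g where "g = (\<lambda>z::'a\<times>real. snd z + 1 / (2 * l) * (norm (x - fst z))\<^sup>2)"
  define M where "M = g (x0, r0)"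
  define S where "S = epi f \<inter> {z. g z \<le> M}"
  have cont: "continuous_on A g" for A
    unfolding g_def by (intro continuous_intros)
  have "closed S"
    unfolding S_def using f cont[of UNIV]
    by (intro closed_Int closed_Collect_le) (auto simp: Gamma0_def)
  moreover have "bounded S"
  proof -
    define K where "K = M - b - v \<bullet> x"
    define R where "R = 1 + 2 * l * \<bar>K\<bar> + 2 * l * norm v"
    have "S \<subseteq> cball x R \<times> {v \<bullet> x - norm v * R + b..M}"
    proof
      fix z assume "z \<in> S"
      obtain u r where z: "z = (u, r)" by (cases z)
      define d where "d = norm (x - u)"
      have ur: "f u \<le> ereal r" and M: "r + 1 / (2 * l) * d\<^sup>2 \<le> M"
        using \<open>z \<in> S\<close> by (auto simp: S_def z epi_def g_def d_def)
      have "v \<bullet> (x - u) \<le> norm v * d"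
        unfolding d_def by (rule norm_cauchy_schwarz)
      then have r: "v \<bullet> x - norm v * d + b \<le> r"
        using minor[OF ur] by (simp add: inner_diff_right)
      have "1 / (2 * l) * d\<^sup>2 \<le> K + norm v * d"
        using r M unfolding K_def by linarith
      then have d2: "d\<^sup>2 \<le> 2 * l * K + 2 * l * norm v * d"
        using l by (simp add: field_simps)
      have "d \<le> R"
      proof (cases "d \<le> 1")
        case True
        then show ?thesis
          using l by (smt (verit) R_def mult_nonneg_nonneg norm_ge_zero abs_ge_zero)
      next
        case False
        have "2 * l * K \<le> 2 * l * \<bar>K\<bar> * 1"
          using l by simp
        also have "\<dots> \<le> 2 * l * \<bar>K\<bar> * d"
          using l False by (intro mult_left_mono) auto
        finally have "d * d \<le> (2 * l * \<bar>K\<bar> + 2 * l * norm v) * d"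
          using d2 by (simp add: power2_eq_square algebra_simps)
        then show ?thesis
          using False unfolding R_def by (simp add: mult_le_cancel_right)
      qed
      moreover have "norm v * d \<le> norm v * R"
        using \<open>d \<le> R\<close> by (simp add: mult_left_mono)
      moreover have "0 \<le> 1 / (2 * l) * d\<^sup>2"
        using l by simp
      ultimately show "z \<in> cball x R \<times> {v \<bullet> x - norm v * R + b..M}"
        using r M by (auto simp: z d_def dist_norm)
    qed
    then show ?thesis
      by (rule bounded_subset[rotated]) (intro bounded_Times bounded_cball bounded_closed_interval)
  qed
  ultimately have "compact S"
    by (simp add: compact_eq_bounded_closed)
  moreover have "(x0, r0) \<in> S"
    using x0 by (simp add: S_def epi_def M_def)
  ultimately obtain z where z: "z \<in> S" "\<And>y. y \<in> S \<Longrightarrow> g z \<le> g y"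
    using continuous_attains_inf[OF _ _ cont] by (metis empty_iff)
  obtain p s where ps: "z = (p, s)" by (cases z)
  have min: "g (p, s) \<le> g (u, r)" if "f u \<le> ereal r" for u r
  proof (cases "g (u, r) \<le> M")
    case True
    then show ?thesis using z(2)[of "(u, r)"] that ps by (simp add: S_def epi_def)
  next
    case False
    then show ?thesis using z(1) ps by (simp add: S_def)
  qed
  have "p \<in> prox l f x"
    unfolding prox_def mem_Collect_eq is_arg_min_linorder
  proof (intro conjI allI impI)
    fix u
    have p: "f p + ereal (1 / (2 * l) * (norm (x - p))\<^sup>2) \<le> ereal (g (p, s))"
      using z(1) ps add_right_mono[of "f p" "ereal s" "ereal (1 / (2 * l) * (norm (x - p))\<^sup>2)"]
      by (simp add: S_def epi_def g_def)
    show "f p + ereal (1 / (2 * l) * (norm (x - p))\<^sup>2) \<le> f u + ereal (1 / (2 * l) * (norm (x - u))\<^sup>2)"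
    proof (cases "f u < \<infinity>")
      case True
      then obtain r where "f u = ereal r" using Gamma0_finite[OF f] by blast
      then show ?thesis using p min[of u r] by (auto simp: g_def intro: order_trans)
    qed auto
  qed simp
  then show ?thesis by blast
qed

text \<open>Fermat's rule for the proximal problem.\<close>

lemma prox_imp_subgradient:
  fixes f :: "'a::euclidean_space \<Rightarrow> ereal"
  assumes f: "f \<in> Gamma0" and l: "l > 0" and p: "p \<in> prox l f x"
  shows "(x - p) /\<^sub>R l \<in> subdifferential f p"
proof -
  have min: "f p + ereal (1 / (2 * l) * (norm (x - p))\<^sup>2) \<le> f u + ereal (1 / (2 * l) * (norm (x - u))\<^sup>2)" for u
    using p by (simp add: prox_def is_arg_min_linorder)
  obtain x0 r0 where "f x0 = ereal r0"
    using Gamma0_edom_nonempty[OF f] .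
  then have "f p < \<infinity>"
    using min[of x0] by (cases "f p") auto
  then obtain a where a: "f p = ereal a"
    using Gamma0_finite[OF f] by blast
  have "f p + ereal (((x - p) /\<^sub>R l) \<bullet> (u - p)) \<le> f u" for u
  proof (cases "f u < \<infinity>")
    case True
    then obtain b where b: "f u = ereal b" using Gamma0_finite[OF f] by blast
    define k where "k = (x - p) \<bullet> (u - p) / l"
    define n where "n = 1 / (2 * l) * (norm (u - p))\<^sup>2"
    have norm_expand: "(norm (w - t *\<^sub>R h))\<^sup>2 = (norm w)\<^sup>2 - 2 * t * (w \<bullet> h) + t\<^sup>2 * (norm h)\<^sup>2"
      for w h :: 'a and t :: real
      unfolding power2_norm_eq_inner
      by (simp add: inner_diff_left inner_diff_right inner_commute power2_eq_square algebra_simps)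
    \<comment> \<open>Comparison of \<open>p\<close> with \<open>p + t (u - p)\<close>, divided by \<open>t\<close>; then \<open>t \<down> 0\<close>.\<close>
    have small: "k \<le> b - a + t * n" if t: "0 < t" "t \<le> 1" for t
    proof -
      define y where "y = p + t *\<^sub>R (u - p)"
      have "(norm (x - y))\<^sup>2 = (norm ((x - p) - t *\<^sub>R (u - p)))\<^sup>2"
        by (simp add: y_def algebra_simps)
      also have "\<dots> = (norm (x - p))\<^sup>2 - 2 * t * ((x - p) \<bullet> (u - p)) + t\<^sup>2 * (norm (u - p))\<^sup>2"
        by (rule norm_expand)
      finally have "1 / (2 * l) * (norm (x - y))\<^sup>2
          = 1 / (2 * l) * (norm (x - p))\<^sup>2 - t * k + t * (t * n)"
        using l by (simp add: k_def n_def field_simps power2_eq_square)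
      moreover have "f y \<le> ereal (a + t * (b - a))"
        unfolding y_def using Gamma0_convex_ineq[OF f a b] t by simp
      then have "ereal a + ereal (1 / (2 * l) * (norm (x - p))\<^sup>2)
          \<le> ereal (a + t * (b - a)) + ereal (1 / (2 * l) * (norm (x - y))\<^sup>2)"
        using order_trans[OF min[of y] add_right_mono] unfolding a by blast
      ultimately have "t * k \<le> t * (b - a + t * n)"
        by (simp add: algebra_simps)
      then show ?thesis
        using t by simp
    qed
    have "k \<le> b - a"
    proof (rule tendsto_lowerbound)
      show "((\<lambda>t. b - a + t * n) \<longlongrightarrow> b - a) (at_right 0)"
        by (auto intro!: tendsto_eq_intros)
      show "\<forall>\<^sub>F t in at_right 0. k \<le> b - a + t * n"
        unfolding eventually_at_right_field using small by (intro exI[of _ 1]) auto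
    qed simp
    then show ?thesis
      using a b by (simp add: k_def divide_inverse mult.commute)
  qed auto
  then show ?thesis
    by (simp add: subdifferential_def)
qed

text \<open>The next two estimates are stated for subgradient inclusions instead of minimizers; they
  carry all quantitative information on \<open>P\<^sub>\<lambda>f\<close> for \<open>\<lambda> > 0\<close>.\<close>

lemma prox_point_estimate:
  fixes f :: "'a::euclidean_space \<Rightarrow> ereal"
  assumes f: "f \<in> Gamma0" and l: "l > 0" and m: "m > 0"
    and p: "(x - p) /\<^sub>R l \<in> subdifferential f p"
    and q: "(y - q) /\<^sub>R m \<in> subdifferential f q"
  shows "norm (p - q) \<le> norm (x - y) + \<bar>l - m\<bar> * (norm (y - q) / m)"
proof -
  define z where "z = (x - y) + (1 - l / m) *\<^sub>R (y - q)"
  have "0 \<le> l * (((x - p) /\<^sub>R l - (y - q) /\<^sub>R m) \<bullet> (p - q))"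
    using subdifferential_monotone[OF f p q] l by simp
  also have "\<dots> = (l *\<^sub>R ((x - p) /\<^sub>R l - (y - q) /\<^sub>R m)) \<bullet> (p - q)"
    by simp
  also have "l *\<^sub>R ((x - p) /\<^sub>R l - (y - q) /\<^sub>R m) = z - (p - q)"
    using l by (simp add: z_def algebra_simps divide_inverse)
  finally have "norm (p - q) * norm (p - q) \<le> z \<bullet> (p - q)"
    by (simp add: inner_diff_left[of z] flip: power2_norm_eq_inner power2_eq_square)
  also have "\<dots> \<le> norm z * norm (p - q)"
    by (rule norm_cauchy_schwarz)
  finally have "norm (p - q) \<le> norm z"
    by (cases "p = q") auto
  also have "\<dots> \<le> norm (x - y) + \<bar>1 - l / m\<bar> * norm (y - q)"
    unfolding z_def by (rule norm_triangle_le) simp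
  also have "\<bar>1 - l / m\<bar> = \<bar>l - m\<bar> / m"
    using m by (simp add: abs_if field_simps)
  finally show ?thesis
    by simp
qed

lemma prox_point_calm:
  fixes f :: "'a::euclidean_space \<Rightarrow> ereal"
  assumes f: "f \<in> Gamma0" and l: "l > 0"
    and p: "(x - p) /\<^sub>R l \<in> subdifferential f p" and v: "v \<in> subdifferential f z"
  shows "norm (p - z) \<le> norm (x - z) + l * norm v"
proof -
  \<comment> \<open>The inclusion at \<open>z\<close> says that \<open>z\<close> is the proximal point of \<open>z + l v\<close>.\<close>
  have "((z + l *\<^sub>R v) - z) /\<^sub>R l \<in> subdifferential f z"
    using v l by simp
  from prox_point_estimate[OF f l l p this]
  have "norm (p - z) \<le> norm ((x - z) - l *\<^sub>R v)"
    by (simp add: algebra_simps)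
  also have "\<dots> \<le> norm (x - z) + norm (l *\<^sub>R v)"
    by (rule norm_triangle_ineq4)
  finally show ?thesis
    using l by simp
qed

lemma prox_eq_singleton:
  fixes f :: "'a::euclidean_space \<Rightarrow> ereal"
  assumes f: "f \<in> Gamma0" and l: "l > 0"
  obtains p where "prox l f x = {p}" "(x - p) /\<^sub>R l \<in> subdifferential f p"
proof -
  obtain p where p: "p \<in> prox l f x"
    using prox_nonempty[OF f l] by blast
  note sub = prox_imp_subgradient[OF f l]
  have "q = p" if "q \<in> prox l f x" for q
    using prox_point_estimate[OF f l l sub[OF that] sub[OF p]] by simp
  then show thesis
    using that p sub[OF p] by blast
qed

section \<open>The map $P_f$ as a single-valued map\<close>

lemma Pmap_subgradient:
  fixes f :: "'a::euclidean_space \<Rightarrow> ereal"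
  assumes "f \<in> Gamma0" "l > 0"
  shows "(x - the_elem (Pmap f (x, l))) /\<^sub>R l \<in> subdifferential f (the_elem (Pmap f (x, l)))"
proof -
  obtain p where "prox l f x = {p}" "(x - p) /\<^sub>R l \<in> subdifferential f p"
    using prox_eq_singleton[OF assms] .
  then show ?thesis
    using assms(2) by (simp add: Pmap_def)
qed

lemma Pmap_zero: "the_elem (Pmap f (x, 0)) = closest_point (closure (edom f)) x"
  by (simp add: Pmap_def)

lemma Pmap_is_singleton:
  fixes f :: "'a::euclidean_space \<Rightarrow> ereal"
  assumes "f \<in> Gamma0" "l \<ge> 0"
  shows "is_singleton (Pmap f (x, l))"
proof (cases "l = 0")
  case True
  then show ?thesis by (simp add: Pmap_def)
next
  case False
  then have "l > 0" using assms(2) by simp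
  obtain p where "prox l f x = {p}"
    using prox_eq_singleton[OF assms(1) \<open>l > 0\<close>] by metis
  then show ?thesis
    using \<open>l > 0\<close> by (simp add: Pmap_def)
qed

lemma set_dom_Pmap:
  fixes f :: "'a::euclidean_space \<Rightarrow> ereal"
  assumes "f \<in> Gamma0"
  shows "set_dom (Pmap f) = UNIV \<times> {0..}"
proof -
  have "Pmap f (x, l) \<noteq> {} \<longleftrightarrow> l \<ge> 0" for x l
    using Pmap_is_singleton[OF assms, of l x] by (auto simp: Pmap_def is_singleton_def)
  then show ?thesis
    by (auto simp: set_dom_def)
qed

text \<open>In the variable \<open>x\<close> alone, every \<open>P\<^sub>f(\<cdot>, l)\<close> is nonexpansive, including the projection.\<close>

lemma Pmap_nonexpansive:
  fixes f :: "'a::euclidean_space \<Rightarrow> ereal"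
  assumes f: "f \<in> Gamma0" and l: "l \<ge> 0"
  shows "norm (the_elem (Pmap f (x, l)) - the_elem (Pmap f (y, l))) \<le> norm (x - y)"
proof (cases "l = 0")
  case True
  have "edom f \<noteq> {}" using f by (simp add: Gamma0_def)
  then show ?thesis
    using closest_point_lipschitz[of "closure (edom f)" x y] convex_edom[OF f] True
    by (simp add: Pmap_zero convex_closure dist_norm)
next
  case False
  then have "l > 0" using l by simp
  from prox_point_estimate[OF f this this Pmap_subgradient[OF f this] Pmap_subgradient[OF f this]]
  show ?thesis by simp
qed

lemma Pmap_locally_lipschitz:
  fixes f :: "'a::euclidean_space \<Rightarrow> ereal"
  assumes f: "f \<in> Gamma0"
  shows "locally_lipschitz_on (UNIV \<times> {0<..}) (\<lambda>p. the_elem (Pmap f p))"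
  unfolding locally_lipschitz_on_def
proof
  let ?P = "\<lambda>x l. the_elem (Pmap f (x, l))"
  fix z :: "'a \<times> real" assume "z \<in> UNIV \<times> {0<..}"
  then obtain x0 l0 where z: "z = (x0, l0)" and l0: "l0 > 0" by auto
  have est: "norm (?P x l - ?P y m) \<le> norm (x - y) + \<bar>l - m\<bar> * (norm (y - ?P y m) / m)"
    if "l > 0" "m > 0" for x l y m
    by (rule prox_point_estimate[OF f that Pmap_subgradient[OF f that(1)] Pmap_subgradient[OF f that(2)]])
  \<comment> \<open>On the ball of radius \<open>l0 / 2\<close> the parameter stays above \<open>l0 / 2\<close>, so the quotient in the
      estimate is bounded there.\<close>
  define e where "e = l0 / 2"
  have e: "e > 0" using l0 by (simp add: e_def)
  define B where "B = 2 * e + norm (x0 - ?P x0 l0) + e * (norm (x0 - ?P x0 l0) / l0)"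
  have B: "B \<ge> 0" using e l0 by (simp add: B_def)
  have near: "norm (y - x0) < e" "\<bar>m - l0\<bar> < e" if "(y, m) \<in> ball z e" for y m
  proof -
    have "dist (y, m) (x0, l0) < e"
      using that by (simp add: z dist_commute)
    then have "norm (y - x0, m - l0) < e"
      by (simp add: dist_norm)
    then show "norm (y - x0) < e" "\<bar>m - l0\<bar> < e"
      using norm_fst_le[of "(y - x0)" "m - l0"] norm_snd_le[of "m - l0" "(y - x0)"] by auto
  qed
  have bound: "norm (y - ?P y m) / m \<le> B / e" if ym: "(y, m) \<in> ball z e" for y m
  proof -
    have m: "m \<ge> e"
      using near(2)[OF ym] unfolding e_def by linarith
    have "norm (y - ?P y m) \<le> norm (y - x0) + norm (x0 - ?P x0 l0) + norm (?P x0 l0 - ?P y m)"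
      using norm_triangle_ineq[of "y - x0" "x0 - ?P x0 l0"]
        norm_triangle_ineq[of "y - ?P x0 l0" "?P x0 l0 - ?P y m"] by simp
    moreover have "norm (?P y m - ?P x0 l0) \<le> norm (y - x0) + \<bar>m - l0\<bar> * (norm (x0 - ?P x0 l0) / l0)"
      using est[of m l0 y x0] m e l0 by simp
    moreover have "\<bar>m - l0\<bar> * (norm (x0 - ?P x0 l0) / l0) \<le> e * (norm (x0 - ?P x0 l0) / l0)"
      using near(2)[OF ym] l0 by (intro mult_right_mono) auto
    ultimately have "norm (y - ?P y m) \<le> B"
      using near(1)[OF ym] by (simp add: B_def norm_minus_commute)
    then show ?thesis
      using m e B by (intro frac_le) auto
  qed
  have "(1 + B / e)-lipschitz_on (ball z e \<inter> UNIV \<times> {0<..}) (\<lambda>p. the_elem (Pmap f p))"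
  proof (rule lipschitz_onI)
    show "0 \<le> 1 + B / e" using B e by simp
    fix p q assume p: "p \<in> ball z e \<inter> UNIV \<times> {0<..}" and q: "q \<in> ball z e \<inter> UNIV \<times> {0<..}"
    obtain x l where pe: "p = (x, l)" by (cases p)
    obtain y m where qe: "q = (y, m)" by (cases q)
    have "norm (?P x l - ?P y m) \<le> norm (x - y) + \<bar>l - m\<bar> * (norm (y - ?P y m) / m)"
      using p q by (intro est) (auto simp: pe qe)
    also have "\<dots> \<le> norm (x - y) + \<bar>l - m\<bar> * (B / e)"
      using bound[of y m] q by (intro add_left_mono mult_left_mono) (auto simp: qe)
    also have "\<dots> \<le> dist p q + dist p q * (B / e)"
      using B e norm_fst_le[of "x - y" "l - m"] norm_snd_le[of "l - m" "x - y"]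
      by (intro add_mono mult_right_mono) (auto simp: pe qe dist_norm)
    finally show "dist (the_elem (Pmap f p)) (the_elem (Pmap f q)) \<le> (1 + B / e) * dist p q"
      by (simp add: pe qe dist_norm algebra_simps)
  qed
  then show "\<exists>e>0. \<exists>L. L-lipschitz_on (ball z e \<inter> UNIV \<times> {0<..}) (\<lambda>p. the_elem (Pmap f p))"
    using e by blast
qed

section \<open>Behaviour as the parameter tends to zero\<close>

lemma prox_point_tendsto_projection:
  fixes f :: "'a::euclidean_space \<Rightarrow> ereal"
  assumes f: "f \<in> Gamma0"
  shows "((\<lambda>l. the_elem (Pmap f (x, l))) \<longlongrightarrow> closest_point (closure (edom f)) x) (at_right 0)"
proof (rule tendstoI)
  fix \<epsilon> :: real assume \<epsilon>: "\<epsilon> > 0"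
  define C where "C = closure (edom f)"
  have C: "closed C" "convex C" "C \<noteq> {}"
    using convex_edom[OF f] f by (auto simp: C_def convex_closure Gamma0_def)
  define c where "c = closest_point C x"
  have "c \<in> closure (edom f)"
    using closest_point_in_set[OF C(1,3)] by (simp add: c_def C_def)
  define D where "D = norm (x - c)"
  \<comment> \<open>The bounds \<open>\<delta>\<close> on the distance of \<open>u\<close> to \<open>c\<close> and \<open>l0\<close> on the parameter are such that each
      error term in the final inequality takes up half of the available amount.\<close>
  define \<delta> where "\<delta> = \<epsilon>\<^sup>2 / (2 * (D + \<epsilon>))"
  have D: "D \<ge> 0" by (simp add: D_def)
  have \<delta>: "\<delta> > 0" using \<epsilon> D by (simp add: \<delta>_def)
  obtain u where u: "u \<in> edom f" "norm (u - c) < \<delta>"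
    using \<open>c \<in> closure (edom f)\<close> \<delta> by (auto simp: closure_approachable dist_norm)
  obtain a where a: "f u = ereal a"
    using u(1) Gamma0_finite[OF f] by (auto simp: edom_def)
  obtain v b where minor: "\<And>x r. f x \<le> ereal r \<Longrightarrow> v \<bullet> x + b \<le> r"
    using Gamma0_affine_minorant[OF f] by blast
  define K where "K = \<bar>a - b - v \<bullet> c\<bar> + norm v * \<epsilon>"
  have K: "K \<ge> 0" using \<epsilon> by (simp add: K_def)
  define l0 where "l0 = \<epsilon>\<^sup>2 / (2 * (K + 1))"
  have l0: "l0 > 0" using \<epsilon> K by (simp add: l0_def)
  have "dist (the_elem (Pmap f (x, l))) c < \<epsilon>" if l: "0 < l" "l < l0" for l
  proof (rule ccontr)
    define p where "p = the_elem (Pmap f (x, l))"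
    define e where "e = norm (p - c)"
    assume "\<not> dist (the_elem (Pmap f (x, l))) c < \<epsilon>"
    then have e: "e \<ge> \<epsilon>" by (simp add: e_def p_def dist_norm)
    have sub: "(x - p) /\<^sub>R l \<in> subdifferential f p"
      unfolding p_def by (rule Pmap_subgradient[OF f l(1)])
    then obtain r where r: "f p = ereal r" using subdifferential_finite[OF f] by blast
    have "f p + ereal (((x - p) /\<^sub>R l) \<bullet> (u - p)) \<le> f u"
      using sub by (simp add: subdifferential_def)
    then have "((x - p) \<bullet> (u - p)) / l \<le> a - r"
      using a r by (simp add: divide_inverse mult.commute)
    then have "(x - p) \<bullet> (u - p) \<le> l * (a - r)"
      using l by (simp add: pos_divide_le_eq mult.commute)
    also have "\<dots> \<le> l * (a - b - v \<bullet> p)"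
      using l minor[of p r] r by (intro mult_left_mono) auto
    finally have upper: "(x - p) \<bullet> (u - p) \<le> l * (a - b - v \<bullet> p)" .
    have "p \<in> C"
      using r closure_subset[of "edom f"] by (auto simp: C_def edom_def)
    then have "(x - c) \<bullet> (p - c) \<le> 0"
      unfolding c_def using C by (intro closest_point_dot) auto
    moreover have "(x - p) \<bullet> (u - p) = (x - p) \<bullet> (u - c) + (e\<^sup>2 - (x - c) \<bullet> (p - c))"
      by (simp add: e_def power2_norm_eq_inner algebra_simps inner_diff_left inner_diff_right inner_commute)
    ultimately have "e\<^sup>2 \<le> l * (a - b - v \<bullet> p) + - ((x - p) \<bullet> (u - c))"
      using upper by linarith
    also have "- ((x - p) \<bullet> (u - c)) \<le> norm (x - p) * norm (u - c)"
      using norm_cauchy_schwarz[of "- (x - p)" "u - c"] by (simp only: norm_minus_cancel inner_minus_left)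
    also have "norm (x - p) * norm (u - c) \<le> (D + e) * \<delta>"
      using norm_triangle_ineq[of "x - c" "c - p"] u(2) D
      by (intro mult_mono) (auto simp: D_def e_def norm_minus_commute)
    also have "l * (a - b - v \<bullet> p) \<le> l * (\<bar>a - b - v \<bullet> c\<bar> + norm v * e)"
    proof (rule mult_left_mono)
      show "a - b - v \<bullet> p \<le> \<bar>a - b - v \<bullet> c\<bar> + norm v * e"
        using norm_cauchy_schwarz[of v "c - p"]
        by (simp add: e_def norm_minus_commute inner_diff_right)
    qed (use l in simp)
    finally have *: "e\<^sup>2 \<le> l * (\<bar>a - b - v \<bullet> c\<bar> + norm v * e) + (D + e) * \<delta>"
      by simp
    \<comment> \<open>Scaling by \<open>\<epsilon>\<close> and using \<open>\<epsilon> \<le> e\<close> makes each of the two terms at most \<open>e \<epsilon>\<^sup>2 / 2\<close>.\<close>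
    have "\<epsilon> * (\<bar>a - b - v \<bullet> c\<bar> + norm v * e) \<le> e * K"
      using mult_right_mono[OF e, of "\<bar>a - b - v \<bullet> c\<bar>"] by (simp add: K_def algebra_simps)
    then have "l * (\<epsilon> * (\<bar>a - b - v \<bullet> c\<bar> + norm v * e)) \<le> l * (e * K)"
      using l by (intro mult_left_mono) auto
    also have "\<dots> \<le> l * (e * (K + 1))"
      using l e \<epsilon> by (intro mult_left_mono) auto
    also have "\<dots> < l0 * (e * (K + 1))"
      using l e \<epsilon> K by (intro mult_strict_right_mono) auto
    also have "\<dots> = e * \<epsilon>\<^sup>2 / 2"
      using K by (simp add: l0_def field_simps)
    finally have t1: "\<epsilon> * (l * (\<bar>a - b - v \<bullet> c\<bar> + norm v * e)) < e * \<epsilon>\<^sup>2 / 2"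
      by (simp add: mult.left_commute)
    have "\<epsilon> * (D + e) \<le> e * (D + \<epsilon>)"
      using mult_right_mono[OF e D] by (simp add: algebra_simps)
    then have "\<epsilon> * (D + e) * \<delta> \<le> e * (D + \<epsilon>) * \<delta>"
      using \<delta> by (intro mult_right_mono) auto
    also have "\<dots> = e * \<epsilon>\<^sup>2 / 2"
      using D \<epsilon> by (simp add: \<delta>_def field_simps)
    finally have t2: "\<epsilon> * ((D + e) * \<delta>) \<le> e * \<epsilon>\<^sup>2 / 2"
      by (simp add: mult.assoc)
    have "\<epsilon> * e\<^sup>2 < e * \<epsilon>\<^sup>2"
      using mult_left_mono[OF *, of \<epsilon>] \<epsilon> t1 t2 by (simp add: distrib_left)
    then have "(\<epsilon> * e) * e < (\<epsilon> * e) * \<epsilon>"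
      by (simp add: power2_eq_square mult_ac)
    moreover have "\<epsilon> * e > 0"
      using e \<epsilon> by simp
    ultimately show False
      using e by (simp only: mult_less_cancel_left_pos)
  qed
  then show "\<forall>\<^sub>F l in at_right 0. dist (the_elem (Pmap f (x, l))) (closest_point (closure (edom f)) x) < \<epsilon>"
    unfolding eventually_at_right_field c_def C_def using l0 by blast
qed

lemma Pmap_continuous_on:
  fixes f :: "'a::euclidean_space \<Rightarrow> ereal"
  assumes f: "f \<in> Gamma0"
  shows "continuous_on (UNIV \<times> {0..}) (\<lambda>p. the_elem (Pmap f p))"
  unfolding continuous_on_iff
proof (intro ballI allI impI)
  let ?P = "\<lambda>x l. the_elem (Pmap f (x, l))"
  fix z :: "'a \<times> real" and \<epsilon> :: real
  assume "z \<in> UNIV \<times> {0..}" and \<epsilon>: "\<epsilon> > 0"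
  then obtain x0 l0 where z: "z = (x0, l0)" and "l0 \<ge> 0" by auto
  \<comment> \<open>By nonexpansiveness, continuity in the parameter alone is enough.\<close>
  have "\<exists>d>0. \<forall>l\<ge>0. \<bar>l - l0\<bar> < d \<longrightarrow> norm (?P x0 l - ?P x0 l0) < \<epsilon> / 2"
  proof (cases "l0 = 0")
    case True
    have "\<forall>\<^sub>F l in at_right 0. dist (?P x0 l) (?P x0 0) < \<epsilon> / 2"
      using tendstoD[OF prox_point_tendsto_projection[OF f, of x0], of "\<epsilon> / 2"] \<epsilon>
      by (simp add: Pmap_zero)
    then obtain d where "d > 0" and d: "\<And>l. 0 < l \<Longrightarrow> l < d \<Longrightarrow> dist (?P x0 l) (?P x0 0) < \<epsilon> / 2"
      unfolding eventually_at_right_field by auto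
    have "norm (?P x0 l - ?P x0 0) < \<epsilon> / 2" if "0 \<le> l" "l < d" for l
      using d[of l] that \<epsilon> by (cases "l = 0") (auto simp: dist_norm)
    then show ?thesis
      using \<open>d > 0\<close> True by auto
  next
    case False
    then have l0: "l0 > 0" using \<open>l0 \<ge> 0\<close> by simp
    define N where "N = norm (x0 - ?P x0 l0) / l0 + 1"
    have N: "N > 0" using l0 unfolding N_def by (intro add_nonneg_pos) auto
    define d where "d = min l0 (\<epsilon> / (2 * N))"
    have "norm (?P x0 l - ?P x0 l0) < \<epsilon> / 2" if l: "\<bar>l - l0\<bar> < d" for l
    proof -
      have "\<bar>l - l0\<bar> < l0" using l by (simp add: d_def)
      then have "l > 0" by linarith
      have "norm (?P x0 l - ?P x0 l0) \<le> \<bar>l - l0\<bar> * (norm (x0 - ?P x0 l0) / l0)"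
        using prox_point_estimate[OF f \<open>l > 0\<close> l0 Pmap_subgradient[OF f \<open>l > 0\<close>]
            Pmap_subgradient[OF f l0], of x0 x0] by simp
      also have "\<dots> \<le> \<bar>l - l0\<bar> * N"
        by (intro mult_left_mono) (auto simp: N_def)
      also have "\<dots> < \<epsilon> / (2 * N) * N"
        using l N by (intro mult_strict_right_mono) (auto simp: d_def)
      finally show ?thesis
        using N by simp
    qed
    moreover have "d > 0" using l0 N \<epsilon> by (simp add: d_def)
    ultimately show ?thesis by blast
  qed
  then obtain d where "d > 0"
    and d: "\<And>l. l \<ge> 0 \<Longrightarrow> \<bar>l - l0\<bar> < d \<Longrightarrow> norm (?P x0 l - ?P x0 l0) < \<epsilon> / 2"
    by blast
  have "dist (the_elem (Pmap f w)) (the_elem (Pmap f z)) < \<epsilon>"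
    if w: "w \<in> UNIV \<times> {0..}" "dist w z < min d (\<epsilon> / 2)" for w
  proof -
    obtain x l where xl: "w = (x, l)" and l: "l \<ge> 0" using w by auto
    have "norm (x - x0, l - l0) < min d (\<epsilon> / 2)"
      using w by (simp add: xl z dist_norm)
    then have x: "norm (x - x0) < \<epsilon> / 2" and l0: "\<bar>l - l0\<bar> < d"
      using norm_fst_le[of "x - x0" "l - l0"] norm_snd_le[of "l - l0" "x - x0"] by auto
    show ?thesis
      using Pmap_nonexpansive[OF f l, of x x0] d[OF l l0] x
        norm_triangle_ineq[of "?P x l - ?P x0 l" "?P x0 l - ?P x0 l0"]
      by (simp add: xl z dist_norm)
  qed
  then show "\<exists>d>0. \<forall>w\<in>UNIV \<times> {0..}. dist w z < d \<longrightarrow>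
      dist (the_elem (Pmap f w)) (the_elem (Pmap f z)) < \<epsilon>"
    using \<open>d > 0\<close> \<epsilon> by (intro exI[of _ "min d (\<epsilon> / 2)"]) auto
qed

lemma Pmap_zero_eq_self:
  fixes f :: "'a::euclidean_space \<Rightarrow> ereal"
  assumes f: "f \<in> Gamma0" and v: "v \<in> subdifferential f z"
  shows "the_elem (Pmap f (z, 0)) = z"
proof -
  obtain a where "f z = ereal a" using subdifferential_finite[OF f v] .
  then have "z \<in> closure (edom f)"
    using closure_subset[of "edom f"] by (auto simp: edom_def)
  then show ?thesis
    by (simp add: Pmap_zero closest_point_self)
qed

lemma Pmap_calm:
  fixes f :: "'a::euclidean_space \<Rightarrow> ereal"
  assumes f: "f \<in> Gamma0" and v: "v \<in> subdifferential f z" and l: "l \<ge> 0"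
  shows "norm (z - the_elem (Pmap f (x, l))) \<le> norm (z - x) + l * norm v"
proof (cases "l = 0")
  case True
  then show ?thesis
    using Pmap_nonexpansive[OF f l, of z x] Pmap_zero_eq_self[OF f v] by simp
next
  case False
  then have "l > 0" using l by simp
  from prox_point_calm[OF f this Pmap_subgradient[OF f this] v]
  show ?thesis by (simp add: norm_minus_commute)
qed

lemma Pmap_lipschitz_parameter:
  fixes f :: "'a::euclidean_space \<Rightarrow> ereal"
  assumes f: "f \<in> Gamma0" and v: "v \<in> subdifferential f z" and l: "l \<ge> 0" and m: "m \<ge> 0"
  shows "norm (the_elem (Pmap f (z, l)) - the_elem (Pmap f (z, m))) \<le> norm v * \<bar>m - l\<bar>"
proof -
  let ?P = "\<lambda>l. the_elem (Pmap f (z, l))"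
  have calm: "norm (z - ?P l) \<le> l * norm v" if "l \<ge> 0" for l
    using Pmap_calm[OF f v that, of z] by simp
  consider "l = 0" | "m = 0" | "l > 0" "m > 0" using l m by linarith
  then show ?thesis
  proof cases
    case 1
    then show ?thesis
      using calm[OF m] m Pmap_zero_eq_self[OF f v] by (simp add: mult.commute)
  next
    case 2
    then show ?thesis
      using calm[OF l] l Pmap_zero_eq_self[OF f v] by (simp add: mult.commute norm_minus_commute)
  next
    case 3
    have "norm (?P l - ?P m) \<le> \<bar>l - m\<bar> * (norm (z - ?P m) / m)"
      using prox_point_estimate[OF f 3 Pmap_subgradient[OF f 3(1)] Pmap_subgradient[OF f 3(2)], of z z]
      by simp
    also have "\<dots> \<le> \<bar>l - m\<bar> * norm v"
      using calm[OF m] 3 by (intro mult_left_mono) (auto simp: field_simps)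
    finally show ?thesis
      by (simp add: mult.commute abs_minus_commute)
  qed
qed

theorem corollary7:
  fixes f :: "'a::euclidean_space \<Rightarrow> ereal"
  assumes "f \<in> Gamma0"
  shows "set_dom (Pmap f) = UNIV \<times> {0..}
    \<and> (\<forall>p \<in> set_dom (Pmap f). is_singleton (Pmap f p))
    \<and> continuous_on (set_dom (Pmap f)) (\<lambda>p. the_elem (Pmap f p))
    \<and> locally_lipschitz_on (interior (set_dom (Pmap f))) (\<lambda>p. the_elem (Pmap f p))
    \<and> (\<forall>xbar \<in> dom_subdifferential f. \<exists>\<kappa>>0. \<exists>\<epsilon>>0.
          (\<forall>x l. (x, l) \<in> ball (xbar, 0) \<epsilon> \<inter> set_dom (Pmap f) \<longrightarrow>
             norm (the_elem (Pmap f (xbar, 0)) - the_elem (Pmap f (x, l)))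
               \<le> \<kappa> * norm (xbar - x, l))
        \<and> (\<forall>l \<in> {0..\<epsilon>}. \<forall>\<mu> \<in> {0..\<epsilon>}.
             norm (the_elem (Pmap f (xbar, l)) - the_elem (Pmap f (xbar, \<mu>)))
               \<le> \<kappa> * \<bar>\<mu> - l\<bar>))"
proof (intro conjI ballI)
  note f = assms
  note dom = set_dom_Pmap[OF f]
  show "set_dom (Pmap f) = UNIV \<times> {0..}" by (rule dom)
  show "is_singleton (Pmap f p)" if "p \<in> set_dom (Pmap f)" for p
    using that Pmap_is_singleton[OF f] unfolding dom by (cases p) auto
  show "continuous_on (set_dom (Pmap f)) (\<lambda>p. the_elem (Pmap f p))"
    unfolding dom by (rule Pmap_continuous_on[OF f])
  show "locally_lipschitz_on (interior (set_dom (Pmap f))) (\<lambda>p. the_elem (Pmap f p))"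
    using Pmap_locally_lipschitz[OF f] by (simp add: dom interior_Times)
  fix z assume "z \<in> dom_subdifferential f"
  then obtain v where v: "v \<in> subdifferential f z"
    by (auto simp: dom_subdifferential_def)
  let ?k = "1 + norm v"
  have "norm (the_elem (Pmap f (z, 0)) - the_elem (Pmap f (x, l))) \<le> ?k * norm (z - x, l)"
    if "l \<ge> 0" for x l
  proof -
    have "norm (z - the_elem (Pmap f (x, l))) \<le> norm (z - x) + l * norm v"
      by (rule Pmap_calm[OF f v that])
    also have "\<dots> \<le> norm (z - x, l) + norm (z - x, l) * norm v"
      using norm_fst_le[of "z - x" l] norm_snd_le[of l "z - x"]
      by (intro add_mono mult_right_mono) auto
    finally show ?thesis
      by (simp add: Pmap_zero_eq_self[OF f v] algebra_simps)
  qed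
  moreover have "norm (the_elem (Pmap f (z, l)) - the_elem (Pmap f (z, m))) \<le> ?k * \<bar>m - l\<bar>"
    if "l \<ge> 0" "m \<ge> 0" for l m
    using Pmap_lipschitz_parameter[OF f v that] by (simp add: distrib_right)
  moreover have "?k > 0"
    by (simp add: add_pos_nonneg)
  ultimately show "\<exists>\<kappa>>0. \<exists>\<epsilon>>0.
          (\<forall>x l. (x, l) \<in> ball (z, 0) \<epsilon> \<inter> set_dom (Pmap f) \<longrightarrow>
             norm (the_elem (Pmap f (z, 0)) - the_elem (Pmap f (x, l))) \<le> \<kappa> * norm (z - x, l))
        \<and> (\<forall>l \<in> {0..\<epsilon>}. \<forall>\<mu> \<in> {0..\<epsilon>}.
             norm (the_elem (Pmap f (z, l)) - the_elem (Pmap f (z, \<mu>))) \<le> \<kappa> * \<bar>\<mu> - l\<bar>)"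
    unfolding dom by (intro exI[of _ ?k] conjI exI[of _ "1::real"]) auto
qed

end
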